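(* Let $D=(V,A)$ be a digraph and let $\phi_{NL}^D(x)$ be its NL-flow polynomial. For every finite Abelian group $G$ of order $k$, the number of NL-$G$-flows in $D$ equals $\phi_{NL}^D(k)$. In particular this number depends only on the order $k$ of $G$.
   Context: Digraphs are finite and may have parallel and antiparallel arcs. A directed cut (dicut) of $D=(V,A)$ is a nonempty set of arcs of the form $\partial^+(X)$, the set of all arcs with tail in $X$ and head in $V\setminus X$, for some $X\subseteq V$ such that no arc has its tail in $V\setminus X$ and its head in $X$. For an Abelian group $G$, a $G$-flow in $D$ is a map $f:A\to G$ with $\sum_{a\in\partial^+(v)}f(a)=\sum_{a\in\partial^-(v)}f(a)$ for all $v\in V$, where $\partial^+(v)$ and $\partial^-(v)$ are the sets of arcs leaving and entering $v$. Its support is $\mathrm{supp}(f)=\{a\in A: f(a)\neq 0\}$. A digraph is totally cyclic if each of its connected components is strongly connected. $D/S$ denotes the digraph obtained by contracting the arcs of $S\subseteq A$. An NL-$G$-flow is a $G$-flow $f$ such that $D/\mathrm{supp}(f)$ is totally cyclic. Let $\mathcal{C}=\{A\setminus C : C=\bigcup_{i=1}^r C_i \text{ for some directed cuts } C_1,\dots,C_r \text{ of } D\}$, where $r=0$ is allowed (so $A\in\mathcal{C}$), partially ordered by reverse inclusion $\supseteq$ (so $B\le B'$ iff $B\supseteq B'$). The Möbius function $\mu$ of a finite poset is defined by $\mu(x,y)=0$ if $x\not\le y$, $\mu(x,x)=1$, and $\mu(x,y)=-\sum_{x\le z<y}\mu(x,z)$ if $x<y$. For $B\subseteq A$, $rk(B)$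 is $|V|$ minus the number of connected components of the graph $(V,B)$ (the rank of the incidence matrix of $(V,B)$). The NL-flow polynomial of $D$ is $$\phi_{NL}^D(x)=\sum_{B\in\mathcal{C}}\mu(A,B)\,x^{|B|-rk(B)},$$ with $\mu$ the Möbius function of $(\mathcal{C},\supseteq)$. *)

theory Defs
  imports
    "Graph_Theory.Digraph_Component"
    "HOL-Algebra.FiniteProduct"
    "HOL-Algebra.Coset"
    "HOL-Computational_Algebra.Polynomial"
begin

text \<open>
  Digraphs are the finite digraphs of \<^locale>\<open>fin_digraph\<close>; arcs are abstract objects with a tail
  and a head, so parallel arcs, antiparallel arcs and loops are all allowed.
\<close>

section \<open>Components, contraction and total cyclicity\<close>

definition spanning_part :: "('a,'b) pre_digraph \<Rightarrow> 'b set \<Rightarrow> ('a,'b) pre_digraph" where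
  "spanning_part D B = D\<lparr>arcs := B\<rparr>"

text \<open>The vertex set of the connected component of \<open>v\<close>, ignoring the directions of the arcs.\<close>

definition component_of :: "('a,'b) pre_digraph \<Rightarrow> 'a \<Rightarrow> 'a set" where
  "component_of D v = {w. v \<rightarrow>\<^sup>*\<^bsub>mk_symmetric D\<^esub> w}"

definition components :: "('a,'b) pre_digraph \<Rightarrow> 'a set set" where
  "components D = component_of D ` verts D"

definition totally_cyclic :: "('a,'b) pre_digraph \<Rightarrow> bool" where
  "totally_cyclic D \<longleftrightarrow> (\<forall>W \<in> components D. strongly_connected (D \<restriction> W))"

text \<open>
  The vertices of \<open>D/S\<close> are the classes of vertices of \<open>D\<close> identified by contracting \<open>S\<close>.
  Arcs outside \<open>S\<close> are kept, possibly as loops.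
\<close>

definition contract :: "('a,'b) pre_digraph \<Rightarrow> 'b set \<Rightarrow> ('a set,'b) pre_digraph" where
  "contract D S =
    \<lparr>verts = components (spanning_part D S),
     arcs = arcs D - S,
     tail = (\<lambda>a. component_of (spanning_part D S) (tail D a)),
     head = (\<lambda>a. component_of (spanning_part D S) (head D a))\<rparr>"

section \<open>Flows\<close>

text \<open>
  Abelian groups are written multiplicatively, so \<open>\<one>\<close> is the zero of the group. Flows are
  extensional (\<open>undefined\<close> outside the arc set), so that counting them counts maps on the arc set.
  A loop at \<open>v\<close> both leaves and enters \<open>v\<close>.
\<close>

definition flows :: "('g,'m) monoid_scheme \<Rightarrow> ('a,'b) pre_digraph \<Rightarrow> ('b \<Rightarrow> 'g) set" where
  "flows G D = {f \<in> arcs D \<rightarrow>\<^sub>E carrier G.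
     \<forall>v \<in> verts D. finprod G f (out_arcs D v) = finprod G f (in_arcs D v)}"

definition supp :: "('g,'m) monoid_scheme \<Rightarrow> ('a,'b) pre_digraph \<Rightarrow> ('b \<Rightarrow> 'g) \<Rightarrow> 'b set" where
  "supp G D f = {a \<in> arcs D. f a \<noteq> \<one>\<^bsub>G\<^esub>}"

definition NL_flows :: "('g,'m) monoid_scheme \<Rightarrow> ('a,'b) pre_digraph \<Rightarrow> ('b \<Rightarrow> 'g) set" where
  "NL_flows G D = {f \<in> flows G D. totally_cyclic (contract D (supp G D f))}"

section \<open>Directed cuts\<close>

definition cut :: "('a,'b) pre_digraph \<Rightarrow> 'a set \<Rightarrow> 'b set" where
  "cut D X = {a \<in> arcs D. tail D a \<in> X \<and> head D a \<in> verts D - X}"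

definition dicuts :: "('a,'b) pre_digraph \<Rightarrow> 'b set set" where
  "dicuts D = {cut D X | X. X \<subseteq> verts D \<and> cut D X \<noteq> {} \<and>
     \<not> (\<exists>a \<in> arcs D. tail D a \<in> verts D - X \<and> head D a \<in> X)}"

definition dicut_complements :: "('a,'b) pre_digraph \<Rightarrow> 'b set set" where
  "dicut_complements D = {arcs D - \<Union>\<K> | \<K>. finite \<K> \<and> \<K> \<subseteq> dicuts D}"

section \<open>The Moebius function of a finite poset\<close>

locale finite_poset =
  fixes P :: "'a set" and le :: "'a \<Rightarrow> 'a \<Rightarrow> bool" (infix "\<sqsubseteq>" 50)
  assumes finite_P: "finite P"
    and refl_le: "reflp_on P (\<sqsubseteq>)"
    and trans_le: "transp_on P (\<sqsubseteq>)"
    and antisym_le: "antisymp_on P (\<sqsubseteq>)"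
begin

function moebius :: "'a \<Rightarrow> 'a \<Rightarrow> int" where
  "moebius x y =
    (if x \<in> P \<and> y \<in> P \<and> x \<sqsubseteq> y then
       if x = y then 1
       else - (\<Sum>z \<in> {z \<in> P. x \<sqsubseteq> z \<and> z \<sqsubseteq> y \<and> z \<noteq> y}. moebius x z)
     else 0)"
  by auto

termination
proof (relation "measure (\<lambda>(x, y). card {z \<in> P. z \<sqsubseteq> y})", goal_cases)
  case (2 x y z)
  then have z: "z \<in> P" "z \<sqsubseteq> y" "z \<noteq> y" and y: "y \<in> P"
    by auto
  have "{w \<in> P. w \<sqsubseteq> z} \<subseteq> {w \<in> P. w \<sqsubseteq> y}"
    using z y transp_onD[OF trans_le] by blast
  moreover have "y \<in> {w \<in> P. w \<sqsubseteq> y}" "y \<notin> {w \<in> P. w \<sqsubseteq> z}"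
    using z y reflp_onD[OF refl_le] antisymp_onD[OF antisym_le] by blast+
  ultimately have "{w \<in> P. w \<sqsubseteq> z} \<subset> {w \<in> P. w \<sqsubseteq> y}"
    by blast
  then show ?case
    using finite_P by (simp add: psubset_card_mono)
qed simp

declare moebius.simps [simp del]

end

lemma (in fin_digraph) finite_poset_dicut_complements:
  "finite_poset (dicut_complements G) (\<supseteq>)"
proof
  have "dicut_complements G \<subseteq> Pow (arcs G)"
    by (auto simp: dicut_complements_def)
  then show "finite (dicut_complements G)"
    by (rule finite_subset) simp
qed (auto intro!: reflp_onI transp_onI antisymp_onI)

section \<open>The NL-flow polynomial\<close>

definition rk :: "('a,'b) pre_digraph \<Rightarrow> 'b set \<Rightarrow> nat" where
  "rk D B = card (verts D) - card (components (spanning_part D B))"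

text \<open>
  Neither subtraction on the naturals truncates: there are at most as many components as vertices,
  and the rank of \<open>B\<close> is at most the size of \<open>B\<close>.
\<close>

definition NL_flow_poly :: "('a,'b) pre_digraph \<Rightarrow> int poly" where
  "NL_flow_poly D = (\<Sum>B \<in> dicut_complements D.
     monom (finite_poset.moebius (dicut_complements D) (\<supseteq>) (arcs D) B) (card B - rk D B))"

end

theory Submission
  imports Defs
begin

text \<open>
  The sets in \<open>dicut_complements D\<close> are closed under intersection, so each flow \<open>f\<close> has a least one
  \<open>cl f\<close> containing its support, and \<open>f\<close> is an NL-flow exactly when \<open>cl f\<close> is the full arc set:
  the contraction of the support is totally cyclic iff no dicut avoids the support. There are
  \<open>k ^ (|B| - rk B)\<close> flows supported in \<open>B\<close>, i.e. with \<open>cl f \<subseteq> B\<close>; weighting these counts with the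
  Moebius function leaves precisely the flows with \<open>cl f\<close> the full arc set.
\<close>

section \<open>Components and total cyclicity\<close>

context wf_digraph
begin

lemma component_of_self: "v \<in> verts G \<Longrightarrow> v \<in> component_of G v"
  by (simp add: component_of_def reachable_def)

lemma component_of_subset_verts: "component_of G v \<subseteq> verts G"
proof -
  interpret S: pair_wf_digraph "mk_symmetric G" ..
  show ?thesis
    by (auto simp: component_of_def dest: S.reachable_in_verts)
qed

lemma component_of_eq:
  assumes "w \<in> component_of G v"
  shows "component_of G w = component_of G v"
proof -
  interpret S: pair_wf_digraph "mk_symmetric G" ..
  have vw: "v \<rightarrow>\<^sup>*\<^bsub>mk_symmetric G\<^esub> w"
    using assms by (simp add: component_of_def)
  have wv: "w \<rightarrow>\<^sup>*\<^bsub>mk_symmetric G\<^esub> v"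
    by (rule symmetric_reachable[OF symmetric_mk_symmetric vw])
  show ?thesis
    unfolding component_of_def using vw wv by (blast intro: S.reachable_trans)
qed

lemma component_of_tail_eq_head:
  assumes "a \<in> arcs G"
  shows "component_of G (tail G a) = component_of G (head G a)"
proof -
  interpret S: pair_wf_digraph "mk_symmetric G" ..
  have "(tail G a, head G a) \<in> parcs (mk_symmetric G)"
    using assms by (auto simp: parcs_mk_symmetric)
  then have "head G a \<in> component_of G (tail G a)"
    using S.reachable_adjI by (auto simp: component_of_def)
  then show ?thesis
    by (simp add: component_of_eq)
qed

text \<open>The tool for bounding components from above: a set \<open>X\<close> whose boundary no
  arc crosses in either direction traps every undirected walk that starts in it. Each use comes down
  to choosing \<open>X\<close>.\<close>

lemma component_of_subset:
  assumes sat: "\<And>a. a \<in> arcs G \<Longrightarrow> tail G a \<in> X \<longleftrightarrow> head G a \<in> X" and "v \<in> X"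
  shows "component_of G v \<subseteq> X"
proof
  fix w
  assume "w \<in> component_of G v"
  then have "v \<rightarrow>\<^sup>*\<^bsub>mk_symmetric G\<^esub> w"
    by (simp add: component_of_def)
  then have "(v, w) \<in> rtrancl_on (verts G) (parcs (mk_symmetric G))"
    by (simp add: reachable_def)
  then show "w \<in> X"
    by (induction rule: rtrancl_on_induct) (use assms in \<open>auto simp: parcs_mk_symmetric\<close>)
qed

lemma mem_component_of_iff:
  "w \<in> verts G \<Longrightarrow> w \<in> component_of G v \<longleftrightarrow> component_of G w = component_of G v"
  using component_of_eq component_of_self by metis

lemma component_eq_component_of: "W \<in> components G \<Longrightarrow> v \<in> W \<Longrightarrow> W = component_of G v"
  by (auto simp: components_def component_of_eq)

lemma components_disjoint: "W \<in> components G \<Longrightarrow> W' \<in> components G \<Longrightarrow> W \<noteq> W' \<Longrightarrow> W \<inter> W' = {}"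
  using component_eq_component_of by blast

text \<open>Replaces components by a condition on single arcs. If every arc has a directed return
  path, the set of vertices reachable from \<open>u\<close> is closed under arcs in both directions,
  so it contains the whole component of \<open>u\<close>. Conversely, the two ends of an arc share a
  component.\<close>

lemma totally_cyclic_iff:
  "totally_cyclic G \<longleftrightarrow> (\<forall>a \<in> arcs G. head G a \<rightarrow>\<^sup>*\<^bsub>G\<^esub> tail G a)"
proof
  assume tc: "totally_cyclic G"
  show "\<forall>a \<in> arcs G. head G a \<rightarrow>\<^sup>*\<^bsub>G\<^esub> tail G a"
  proof
    fix a
    assume a: "a \<in> arcs G"
    define W where "W = component_of G (tail G a)"
    have "W \<in> components G" "tail G a \<in> W" "head G a \<in> W"
      using a component_of_tail_eq_head[OF a] component_of_self[of "tail G a"]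
        component_of_self[of "head G a"]
      by (auto simp: W_def components_def)
    then have "head G a \<rightarrow>\<^sup>*\<^bsub>G \<restriction> W\<^esub> tail G a"
      using tc by (auto simp: totally_cyclic_def strongly_connected_def)
    moreover have "subgraph (G \<restriction> W) G"
      using component_of_subset_verts by (auto simp: W_def intro!: subgraph_induce_subgraphI)
    ultimately show "head G a \<rightarrow>\<^sup>*\<^bsub>G\<^esub> tail G a"
      by (rule reachable_mono)
  qed
next
  assume returns: "\<forall>a \<in> arcs G. head G a \<rightarrow>\<^sup>*\<^bsub>G\<^esub> tail G a"
  show "totally_cyclic G"
    unfolding totally_cyclic_def strongly_connected_def
  proof (intro ballI conjI)
    fix W
    assume W: "W \<in> components G"
    then show "verts (G \<restriction> W) \<noteq> {}"
      using component_of_self by (auto simp: components_def)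
    have W_sub: "W \<subseteq> verts G"
      using W component_of_subset_verts by (auto simp: components_def)
    fix u w
    assume "u \<in> verts (G \<restriction> W)" and w: "w \<in> verts (G \<restriction> W)"
    then have u: "u \<in> W" and uV: "u \<in> verts G"
      using W_sub by auto
    \<comment> \<open>A directed walk from \<open>u\<close> never leaves the component
      \<open>W\<close>, so it survives in the induced subgraph.\<close>
    have reach: "u \<rightarrow>\<^sup>*\<^bsub>G \<restriction> W\<^esub> x" if "u \<rightarrow>\<^sup>*\<^bsub>G\<^esub> x" for x
    proof -
      have "x \<in> W \<and> u \<rightarrow>\<^sup>*\<^bsub>G \<restriction> W\<^esub> x"
        using that
      proof (induction rule: reachable_induct)
        case base
        then show ?case using u by (simp add: reachable_def)
      next
        case (step x y)
        from step.hyps(2) obtain a where a: "a \<in> arcs G" "tail G a = x" "head G a = y"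
          by (rule reachableE)
        have "x \<in> W" using step.IH by blast
        then have "W = component_of G x"
          by (rule component_eq_component_of[OF W])
        also have "\<dots> = component_of G y"
          using component_of_tail_eq_head[OF a(1)] a(2,3) by simp
        finally have "y \<in> W"
          using component_of_self[of y] a by auto
        moreover have "(x, y) \<in> arcs_ends (G \<restriction> W)"
          using a \<open>x \<in> W\<close> \<open>y \<in> W\<close> by (auto simp: arcs_ends_def arc_to_ends_def induce_subgraph_def)
        ultimately show ?case
          using step by (auto simp: reachable_def intro: rtrancl_on_into_rtrancl_on)
      qed
      then show ?thesis by blast
    qed
    have "component_of G u \<subseteq> {x. u \<rightarrow>\<^sup>*\<^bsub>G\<^esub> x}"
    proof (rule component_of_subset)
      fix a
      assume a: "a \<in> arcs G"
      then have "tail G a \<rightarrow>\<^bsub>G\<^esub> head G a"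
        by (rule in_arcs_imp_in_arcs_ends)
      then show "tail G a \<in> {x. u \<rightarrow>\<^sup>*\<^bsub>G\<^esub> x} \<longleftrightarrow> head G a \<in> {x. u \<rightarrow>\<^sup>*\<^bsub>G\<^esub> x}"
        using returns a by (blast intro: reachable_trans reachable_adj_trans)
    qed (use uV in simp)
    then show "u \<rightarrow>\<^sup>*\<^bsub>G \<restriction> W\<^esub> w"
      using w component_eq_component_of[OF W u] reach by auto
  qed
qed

end

section \<open>Total cyclicity of a contraction in terms of dicuts\<close>

lemma (in wf_digraph) wf_digraph_spanning_part:
  "B \<subseteq> arcs G \<Longrightarrow> wf_digraph (spanning_part G B)"
  by unfold_locales (auto simp: spanning_part_def)

lemma spanning_part_simps [simp]:
  "verts (spanning_part D B) = verts D" "arcs (spanning_part D B) = B"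
  "tail (spanning_part D B) = tail D" "head (spanning_part D B) = head D"
  by (simp_all add: spanning_part_def)

lemma contract_simps [simp]:
  "verts (contract D S) = components (spanning_part D S)" "arcs (contract D S) = arcs D - S"
  "tail (contract D S) a = component_of (spanning_part D S) (tail D a)"
  "head (contract D S) a = component_of (spanning_part D S) (head D a)"
  by (simp_all add: contract_def)

lemma (in wf_digraph) wf_digraph_contract: "wf_digraph (contract G S)"
  by unfold_locales (auto simp: components_def)

text \<open>A dicut that avoids \<open>S\<close> survives contraction and blocks the return of its
  arcs. Conversely, if an arc has no return path in the contraction, the vertices whose classes
  cannot be reached from its head define a dicut that avoids \<open>S\<close>.\<close>

lemma (in wf_digraph) totally_cyclic_contract_iff:
  assumes S: "S \<subseteq> arcs G"
  shows "totally_cyclic (contract G S) \<longleftrightarrow> (\<forall>C \<in> dicuts G. C \<inter> S \<noteq> {})"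
proof -
  interpret P: wf_digraph "spanning_part G S"
    by (rule wf_digraph_spanning_part[OF S])
  interpret E: wf_digraph "contract G S"
    by (rule wf_digraph_contract)
  let ?c = "component_of (spanning_part G S)"
  have c_eq: "?c (tail G a) = ?c (head G a)" if "a \<in> S" for a
    using P.component_of_tail_eq_head[of a] that by simp
  show ?thesis
    unfolding E.totally_cyclic_iff
  proof (intro iffI ballI notI)
    fix C
    assume returns: "\<forall>a \<in> arcs (contract G S).
        head (contract G S) a \<rightarrow>\<^sup>*\<^bsub>contract G S\<^esub> tail (contract G S) a"
      and C: "C \<in> dicuts G" and disj: "C \<inter> S = {}"
    obtain X where X: "X \<subseteq> verts G" "C = cut G X" "cut G X \<noteq> {}"
      and no_in: "\<And>a. a \<in> arcs G \<Longrightarrow> tail G a \<in> verts G - X \<Longrightarrow> head G a \<notin> X"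
      using C by (auto simp: dicuts_def)
    \<comment> \<open>No arc of \<open>S\<close> leaves \<open>X\<close>, because the dicut avoids
      \<open>S\<close>, and no arc at all enters \<open>X\<close>. Hence \<open>X\<close> is a union
      of contraction classes.\<close>
    have c_sub: "?c v \<subseteq> X" if "v \<in> X" for v
    proof (rule P.component_of_subset)
      fix a
      assume "a \<in> arcs (spanning_part G S)"
      then have a: "a \<in> S" "a \<in> arcs G" using S by auto
      then have "a \<notin> cut G X" using disj X by blast
      then show "tail (spanning_part G S) a \<in> X \<longleftrightarrow> head (spanning_part G S) a \<in> X"
        using no_in a by (auto simp: cut_def)
    qed (rule that)
    have c_iff: "?c v \<subseteq> X \<longleftrightarrow> v \<in> X" if "v \<in> verts G" for v
      using c_sub P.component_of_self[of v] that by auto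
    obtain a where a: "a \<in> cut G X" using X by blast
    then have aG: "a \<in> arcs G" "a \<notin> S" "tail G a \<in> X" "head G a \<notin> X"
      using X disj by (auto simp: cut_def)
    \<comment> \<open>Invariant along walks of the contraction: from outside \<open>X\<close> no arc
      leads back in. The class of \<open>tail G a\<close> lies inside \<open>X\<close>, so it is
      never reached from the head.\<close>
    have "\<not> K \<subseteq> X" if "?c (head G a) \<rightarrow>\<^sup>*\<^bsub>contract G S\<^esub> K" for K
      using that
    proof (induction rule: E.reachable_induct)
      case base
      then show ?case using c_iff aG by simp
    next
      case (step K L)
      from step.hyps(2) obtain b where "b \<in> arcs (contract G S)" "tail (contract G S) b = K"
          "head (contract G S) b = L"
        by (rule reachableE)
      then show ?case
        using no_in[of b] step c_iff[of "tail G b"] c_iff[of "head G b"] by auto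
    qed
    then show False
      using returns aG c_sub[of "tail G a"] by auto
  next
    fix a
    assume hit: "\<forall>C \<in> dicuts G. C \<inter> S \<noteq> {}" and "a \<in> arcs (contract G S)"
    then have a: "a \<in> arcs G" "a \<notin> S" by auto
    let ?r = "\<lambda>v. ?c (head G a) \<rightarrow>\<^sup>*\<^bsub>contract G S\<^esub> ?c v"
    have r_step: "?r (head G b)" if "b \<in> arcs G" "?r (tail G b)" for b
    proof (cases "b \<in> S")
      case True
      then show ?thesis using that c_eq by simp
    next
      case False
      then have "?c (tail G b) \<rightarrow>\<^bsub>contract G S\<^esub> ?c (head G b)"
        using E.in_arcs_imp_in_arcs_ends[of b] that by simp
      then show ?thesis using that by (blast intro: E.reachable_adj_trans)
    qed
    have r_head: "?r (head G a)"
      using a by (intro E.reachable_refl) (auto simp: components_def)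
    show "head (contract G S) a \<rightarrow>\<^sup>*\<^bsub>contract G S\<^esub> tail (contract G S) a"
    proof (rule ccontr)
      assume "\<not> ?thesis"
      then have not_r: "\<not> ?r (tail G a)" by simp
      \<comment> \<open>By \<open>r_step\<close> no arc enters \<open>Y\<close>, while
        \<open>a\<close> leaves it, so \<open>cut G Y\<close> is a dicut. An arc of \<open>S\<close>
        has both ends in one class and therefore cannot cross.\<close>
      define Y where "Y = {v \<in> verts G. \<not> ?r v}"
      have "a \<in> cut G Y"
        using a not_r r_head by (auto simp: cut_def Y_def)
      then have "cut G Y \<in> dicuts G"
        using r_step by (auto simp: dicuts_def Y_def)
      then obtain b where "b \<in> cut G Y" "b \<in> S" using hit by blast
      then show False
        using c_eq by (auto simp: cut_def Y_def)
    qed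
  qed
qed

section \<open>Components and rank under insertion of an arc\<close>

context wf_digraph
begin

text \<open>Both inclusions come from closure under arcs: \<open>U\<close> is crossed by no arc of
  \<open>insert e B\<close>, and a component away from \<open>U\<close> is not crossed by
  \<open>e\<close> either. If both ends of \<open>e\<close> already share a component,
  \<open>U\<close> is that component.\<close>

lemma component_of_insert:
  assumes B: "insert e B \<subseteq> arcs G" and v: "v \<in> verts G"
  shows "component_of (spanning_part G (insert e B)) v =
    (let U = component_of (spanning_part G B) (tail G e) \<union> component_of (spanning_part G B) (head G e)
     in if v \<in> U then U else component_of (spanning_part G B) v)"
proof -
  interpret P: wf_digraph "spanning_part G B"
    by (rule wf_digraph_spanning_part) (use B in auto)
  interpret I: wf_digraph "spanning_part G (insert e B)"
    by (rule wf_digraph_spanning_part) (use B in auto)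
  let ?c = "component_of (spanning_part G B)" and ?c' = "component_of (spanning_part G (insert e B))"
  define U where "U = ?c (tail G e) \<union> ?c (head G e)"
  have ends: "tail G e \<in> verts G" "head G e \<in> verts G" using B by auto
  have sat: "tail G a \<in> ?c w \<longleftrightarrow> head G a \<in> ?c w" if "a \<in> B" for a w
    using P.component_of_tail_eq_head[of a] P.mem_component_of_iff[of "tail G a"]
      P.mem_component_of_iff[of "head G a"] that B by auto
  have sat': "tail G a \<in> ?c' w \<longleftrightarrow> head G a \<in> ?c' w" if "a \<in> insert e B" for a w
    using I.component_of_tail_eq_head[of a] I.mem_component_of_iff[of "tail G a"]
      I.mem_component_of_iff[of "head G a"] that B by auto
  \<comment> \<open>A component for \<open>insert e B\<close> is in particular not crossed by arcs
    of \<open>B\<close>.\<close>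
  have mono: "?c w \<subseteq> ?c' w" if "w \<in> verts G" for w
    using sat' that by (intro P.component_of_subset) (auto intro!: I.component_of_self)
  have eU: "tail G e \<in> U" "head G e \<in> U"
    using P.component_of_self ends by (auto simp: U_def)
  show ?thesis
  proof (cases "v \<in> U")
    case True
    have "?c' v \<subseteq> U"
      using True eU sat by (intro I.component_of_subset) (auto simp: U_def)
    moreover have "?c' (tail G e) = ?c' (head G e)"
      using I.component_of_tail_eq_head[of e] by simp
    then have "U \<subseteq> ?c' (tail G e)"
      using mono ends unfolding U_def by auto
    then have "U \<subseteq> ?c' v"
      using I.component_of_eq[of v] True by auto
    ultimately have "?c' v = U" by blast
    then show ?thesis using True by (simp add: U_def)
  next
    case False
    have "tail G e \<notin> ?c v" "head G e \<notin> ?c v"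
      using False P.mem_component_of_iff[of _ v] P.mem_component_of_iff[of v] ends v
      by (auto simp: U_def)
    then have "?c' v \<subseteq> ?c v"
      using sat v by (intro I.component_of_subset) (auto intro!: P.component_of_self)
    then have "?c' v = ?c v" using mono v by blast
    then show ?thesis using False by (simp add: U_def)
  qed
qed

text \<open>Covers both cases at once: if the two components coincide, the one that is removed is
  inserted again.\<close>

lemma components_insert:
  assumes B: "insert e B \<subseteq> arcs G"
  shows "components (spanning_part G (insert e B)) =
    (let W1 = component_of (spanning_part G B) (tail G e);
         W2 = component_of (spanning_part G B) (head G e)
     in insert (W1 \<union> W2) (components (spanning_part G B) - {W1, W2}))"
proof -
  interpret P: wf_digraph "spanning_part G B"
    by (rule wf_digraph_spanning_part) (use B in auto)
  let ?c = "component_of (spanning_part G B)" and ?c' = "component_of (spanning_part G (insert e B))"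
  let ?U = "?c (tail G e) \<union> ?c (head G e)"
  have ends: "tail G e \<in> verts G" "head G e \<in> verts G" using B by auto
  have c': "?c' v = (if v \<in> ?U then ?U else ?c v)" if "v \<in> verts G" for v
    using component_of_insert[OF B that] by simp
  have in_U: "v \<in> ?U \<longleftrightarrow> ?c v \<in> {?c (tail G e), ?c (head G e)}" if "v \<in> verts G" for v
    using P.mem_component_of_iff[of v] that by auto
  have tU: "tail G e \<in> ?U"
    using in_U ends by auto
  have "components (spanning_part G (insert e B)) =
      (\<lambda>v. if v \<in> ?U then ?U else ?c v) ` verts G"
    unfolding components_def using c' by (intro image_cong) auto
  also have "\<dots> = insert ?U (?c ` verts G - {?c (tail G e), ?c (head G e)})"
  proof (intro equalityI subsetI)
    fix W
    assume "W \<in> insert ?U (?c ` verts G - {?c (tail G e), ?c (head G e)})"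
    then consider "W = ?U" | v where "v \<in> verts G" "W = ?c v" "v \<notin> ?U"
      using in_U by blast
    then show "W \<in> (\<lambda>v. if v \<in> ?U then ?U else ?c v) ` verts G"
    proof cases
      case 1
      then show ?thesis using tU ends by (intro image_eqI[of _ _ "tail G e"]) auto
    next
      case 2
      then show ?thesis by (intro image_eqI[of _ _ v]) auto
    qed
  qed (use in_U in auto)
  finally show ?thesis by (simp add: components_def Let_def)
qed

end

context fin_digraph
begin

lemma finite_components: "finite (components (spanning_part G B))"
  by (simp add: components_def)

lemma card_components_le: "card (components (spanning_part G B)) \<le> card (verts G)"
  by (simp add: components_def card_image_le)

lemma card_components_insert:
  assumes B: "insert e B \<subseteq> arcs G"
    and ne: "component_of (spanning_part G B) (tail G e) \<noteq> component_of (spanning_part G B) (head G e)"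
  shows "Suc (card (components (spanning_part G (insert e B)))) = card (components (spanning_part G B))"
proof -
  interpret P: wf_digraph "spanning_part G B"
    by (rule wf_digraph_spanning_part) (use B in auto)
  let ?W1 = "component_of (spanning_part G B) (tail G e)"
    and ?W2 = "component_of (spanning_part G B) (head G e)"
    and ?C = "components (spanning_part G B)"
  have mem: "?W1 \<in> ?C" "?W2 \<in> ?C"
    using B by (auto simp: components_def)
  have "tail G e \<in> ?W1"
    using B by (intro P.component_of_self) auto
  \<comment> \<open>The merged class is new: it contains \<open>tail G e\<close>, whereas every old
    component other than \<open>?W1\<close> is disjoint from \<open>?W1\<close>. So two classes are
    lost and exactly one is gained.\<close>
  then have "?W1 \<union> ?W2 \<notin> ?C - {?W1, ?W2}"
    using P.components_disjoint[OF mem(1)] by blast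
  then have "card (components (spanning_part G (insert e B))) = Suc (card (?C - {?W1, ?W2}))"
    using finite_components by (simp add: components_insert[OF B] Let_def)
  also have "card (?C - {?W1, ?W2}) = card ?C - 2"
    using mem ne by (subst card_Diff_subset) auto
  also have "Suc (card ?C - 2) = card ?C - 1"
  proof -
    have "card {?W1, ?W2} \<le> card ?C"
      using mem finite_components by (intro card_mono) auto
    then show ?thesis using ne by simp
  qed
  moreover have "card ?C > 0"
    using mem finite_components by (auto simp: card_gt_0_iff)
  ultimately show ?thesis by simp
qed

lemma components_insert_same:
  assumes B: "insert e B \<subseteq> arcs G"
    and eq: "component_of (spanning_part G B) (tail G e) = component_of (spanning_part G B) (head G e)"
  shows "components (spanning_part G (insert e B)) = components (spanning_part G B)"
  using B by (auto simp: components_insert[OF B] Let_def eq) (auto simp: components_def)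

lemma components_empty: "components (spanning_part G {}) = (\<lambda>v. {v}) ` verts G"
proof -
  interpret P: wf_digraph "spanning_part G {}"
    by (rule wf_digraph_spanning_part) simp
  have "component_of (spanning_part G {}) v = {v}" if "v \<in> verts G" for v
    using P.component_of_subset[of "{v}" v] P.component_of_self[of v] that by auto
  then show ?thesis by (auto simp: components_def)
qed

lemma rk_empty: "rk G {} = 0"
  by (simp add: rk_def components_empty card_image)

text \<open>The case distinction that drives the counting induction: an arc either closes an
  undirected cycle, or merges two components and raises the rank.\<close>

lemma rk_insert:
  assumes B: "insert e B \<subseteq> arcs G"
  shows "rk G (insert e B) =
    (if component_of (spanning_part G B) (tail G e) = component_of (spanning_part G B) (head G e)
     then rk G B else Suc (rk G B))"
proof (cases "component_of (spanning_part G B) (tail G e) = component_of (spanning_part G B) (head G e)")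
  case True
  then show ?thesis using components_insert_same[OF B] by (simp add: rk_def)
next
  case False
  then show ?thesis
    using card_components_insert[OF B False] card_components_le[of B] by (simp add: rk_def)
qed

text \<open>Makes \<open>card B - rk G B\<close> a true difference, so that it grows by one when an
  arc is added without changing the rank.\<close>

lemma rk_le_card:
  assumes "B \<subseteq> arcs G"
  shows "rk G B \<le> card B"
proof -
  have "finite B" using assms finite_arcs by (rule finite_subset)
  then show ?thesis using assms
    by (induction rule: finite_induct) (auto simp: rk_empty rk_insert)
qed

end

section \<open>Counting flows with given support bound\<close>

locale group_digraph = fin_digraph D + comm_group G
  for D :: "('a,'b) pre_digraph" and G :: "('g,'m) monoid_scheme" (structure) +
  assumes finite_carrier: "finite (carrier G)"
begin

text \<open>The maps on \<open>B\<close> whose net outflow is \<open>b v\<close> at every vertex \<open>v\<close>. Prescribing a nonzero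
  outflow is what makes the count accessible to induction on \<open>B\<close>.\<close>

definition flows_with_outflow :: "'b set \<Rightarrow> ('a \<Rightarrow> 'g) \<Rightarrow> ('b \<Rightarrow> 'g) set" where
  "flows_with_outflow B b = {f \<in> B \<rightarrow>\<^sub>E carrier G. \<forall>v \<in> verts D.
     finprod G f {a \<in> B. tail D a = v} = b v \<otimes> finprod G f {a \<in> B. head D a = v}}"

definition point_mass :: "'a \<Rightarrow> 'g \<Rightarrow> 'a \<Rightarrow> 'g" where
  "point_mass u g = (\<lambda>v. if v = u then g else \<one>)"

text \<open>The solvability condition for a prescribed outflow: an arc contributes to its component
  once as leaving and once as entering, so the total outflow there must cancel. That this also
  suffices follows from the count in \<open>card_flows_with_outflow\<close>.\<close>

definition balanced :: "'b set \<Rightarrow> ('a \<Rightarrow> 'g) \<Rightarrow> bool" where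
  "balanced B b \<longleftrightarrow> (\<forall>W \<in> components (spanning_part D B). finprod G b W = \<one>)"

text \<open>The outflow that remains to be realised once the arc \<open>e\<close> carries \<open>g\<close>.\<close>

definition residual :: "'b \<Rightarrow> 'g \<Rightarrow> ('a \<Rightarrow> 'g) \<Rightarrow> 'a \<Rightarrow> 'g" where
  "residual e g b =
    (\<lambda>v. b v \<otimes> (point_mass (head D e) g v \<otimes> point_mass (tail D e) (inv g) v))"

lemma point_mass_closed [simp]: "g \<in> carrier G \<Longrightarrow> point_mass u g v \<in> carrier G"
  by (simp add: point_mass_def)

lemma finprod_point_mass:
  assumes "finite W" "g \<in> carrier G"
  shows "finprod G (point_mass u g) W = (if u \<in> W then g else \<one>)"
  using assms finprod_singleton_swap[of u W "\<lambda>_. g"]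
  by (auto simp: point_mass_def intro!: finprod_one_eqI)

lemma residual_closed:
  assumes "b \<in> verts D \<rightarrow> carrier G" "g \<in> carrier G"
  shows "residual e g b \<in> verts D \<rightarrow> carrier G"
  using assms by (auto simp: residual_def)

lemma finprod_residual:
  assumes b: "b \<in> verts D \<rightarrow> carrier G" and g: "g \<in> carrier G" and W: "W \<subseteq> verts D"
  shows "finprod G (residual e g b) W = finprod G b W \<otimes>
    ((if head D e \<in> W then g else \<one>) \<otimes> (if tail D e \<in> W then inv g else \<one>))"
proof -
  have fin: "finite W" using W finite_verts by (rule finite_subset)
  have bW: "b \<in> W \<rightarrow> carrier G" using b W by auto
  show ?thesis
    unfolding residual_def using fin bW g
    by (simp add: finprod_multf finprod_point_mass Pi_def)
qed

text \<open>The contribution of \<open>e\<close> is a known constant once \<open>g\<close> is fixed.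
  Moving it into the prescribed outflow multiplies by \<open>g\<close> at the head and by
  \<open>inv g\<close> at the tail.\<close>

lemma flows_with_outflow_insert_iff:
  assumes "insert e B \<subseteq> arcs D" "e \<notin> B"
    and b: "b \<in> verts D \<rightarrow> carrier G" and g: "g \<in> carrier G" and f: "f \<in> B \<rightarrow>\<^sub>E carrier G"
  shows "f(e := g) \<in> flows_with_outflow (insert e B) b \<longleftrightarrow> f \<in> flows_with_outflow B (residual e g b)"
proof -
  have finB: "finite B" using assms(1) finite_subset[OF _ finite_arcs] by auto
  have fB: "f \<in> X \<rightarrow> carrier G" if "X \<subseteq> B" for X using f that by auto
  \<comment> \<open>One computation serves both \<open>tail D\<close> and \<open>head D\<close>. As
    the two ends are treated separately, a loop needs no case of its own.\<close>
  have split: "finprod G (f(e := g)) {a \<in> insert e B. p a = v} =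
      point_mass (p e) g v \<otimes> finprod G f {a \<in> B. p a = v}" for p :: "'b \<Rightarrow> 'a" and v
  proof -
    have eq: "finprod G (f(e := g)) {a \<in> B. p a = v} = finprod G f {a \<in> B. p a = v}"
      using \<open>e \<notin> B\<close> by (intro finprod_cong') (auto intro!: fB)
    show ?thesis
    proof (cases "p e = v")
      case True
      then have "{a \<in> insert e B. p a = v} = insert e {a \<in> B. p a = v}" by auto
      moreover have "f(e := g) \<in> {a \<in> B. p a = v} \<rightarrow> carrier G"
        using f g by auto
      ultimately show ?thesis
        using True finB \<open>e \<notin> B\<close> g by (simp add: eq point_mass_def)
    next
      case False
      then have "{a \<in> insert e B. p a = v} = {a \<in> B. p a = v}" by auto
      then show ?thesis using False eq fB[of "{a \<in> B. p a = v}"]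
        by (auto simp: point_mass_def)
    qed
  qed
  \<comment> \<open>Here \<open>x\<close> and \<open>y\<close> stand for the contributions of
    \<open>e\<close> at its tail and head, and \<open>c\<close> for the prescribed outflow.\<close>
  have solve: "x \<otimes> s = c \<otimes> (y \<otimes> t) \<longleftrightarrow> s = c \<otimes> (y \<otimes> inv x) \<otimes> t"
    if "x \<in> carrier G" "y \<in> carrier G" "c \<in> carrier G" "s \<in> carrier G" "t \<in> carrier G" for x y c s t
  proof -
    have "s = inv x \<otimes> (c \<otimes> (y \<otimes> t)) \<longleftrightarrow> c \<otimes> (y \<otimes> t) = x \<otimes> s"
      using that by (intro inv_solve_left) auto
    moreover have "inv x \<otimes> (c \<otimes> (y \<otimes> t)) = c \<otimes> (y \<otimes> inv x) \<otimes> t"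
      using that by (simp add: m_ac)
    ultimately show ?thesis by auto
  qed
  have inv_mass: "inv (point_mass u g v) = point_mass u (inv g) v" for u v
    by (simp add: point_mass_def)
  have "f(e := g) \<in> insert e B \<rightarrow>\<^sub>E carrier G"
    using f g by (auto simp: PiE_def extensional_def)
  moreover have "finprod G (f(e := g)) {a \<in> insert e B. tail D a = v} =
        b v \<otimes> finprod G (f(e := g)) {a \<in> insert e B. head D a = v} \<longleftrightarrow>
      finprod G f {a \<in> B. tail D a = v} = residual e g b v \<otimes> finprod G f {a \<in> B. head D a = v}"
    if "v \<in> verts D" for v
    unfolding split residual_def inv_mass[symmetric]
    by (rule solve) (use g b that in \<open>auto intro!: finprod_closed fB\<close>)
  ultimately show ?thesis
    using f by (auto simp: flows_with_outflow_def)
qed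

lemma finite_flows_with_outflow: "finite B \<Longrightarrow> finite (flows_with_outflow B b)"
  unfolding flows_with_outflow_def
  by (rule finite_subset[of _ "B \<rightarrow>\<^sub>E carrier G"]) (auto simp: finite_carrier intro!: finite_PiE)

text \<open>A map on \<open>insert e B\<close> is the same as its value at \<open>e\<close> together
  with a map on \<open>B\<close>; the count is fibred over that value.\<close>

lemma card_flows_with_outflow_insert:
  assumes B: "insert e B \<subseteq> arcs D" "e \<notin> B" and b: "b \<in> verts D \<rightarrow> carrier G"
  shows "card (flows_with_outflow (insert e B) b) =
    (\<Sum>g \<in> carrier G. card (flows_with_outflow B (residual e g b)))"
proof -
  have finB: "finite B" using B(1) finite_subset[OF _ finite_arcs] by auto
  let ?S = "SIGMA g : carrier G. flows_with_outflow B (residual e g b)"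
  have sub: "?S \<subseteq> carrier G \<times> (B \<rightarrow>\<^sub>E carrier G)"
    by (auto simp: flows_with_outflow_def)
  have "flows_with_outflow (insert e B) b = (\<lambda>(g, f). f(e := g)) ` ?S"
  proof (intro equalityI subsetI)
    fix h
    assume h: "h \<in> flows_with_outflow (insert e B) b"
    then have "h \<in> (\<lambda>(g, f). f(e := g)) ` (carrier G \<times> (B \<rightarrow>\<^sub>E carrier G))"
      unfolding flows_with_outflow_def PiE_insert_eq by auto
    then obtain g f where gf: "h = f(e := g)" "g \<in> carrier G" "f \<in> B \<rightarrow>\<^sub>E carrier G"
      by auto
    then show "h \<in> (\<lambda>(g, f). f(e := g)) ` ?S"
      using h flows_with_outflow_insert_iff[OF B b gf(2,3)]
      by (intro image_eqI[of _ _ "(g, f)"]) auto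
  next
    fix h
    assume "h \<in> (\<lambda>(g, f). f(e := g)) ` ?S"
    then show "h \<in> flows_with_outflow (insert e B) b"
      using flows_with_outflow_insert_iff[OF B b] sub by auto
  qed
  moreover have "inj_on (\<lambda>(g, f). f(e := g)) ?S"
    using inj_combinator[of e B "\<lambda>_. carrier G"] B sub by (auto intro: inj_on_subset)
  ultimately have "card (flows_with_outflow (insert e B) b) = card ?S"
    by (simp add: card_image)
  also have "\<dots> = (\<Sum>g \<in> carrier G. card (flows_with_outflow B (residual e g b)))"
    using finB by (intro card_SigmaI) (auto simp: finite_carrier finite_flows_with_outflow)
  finally show ?thesis .
qed

section \<open>Solvability and number of solutions, one arc at a time\<close>

lemma components_subset_verts:
  assumes "W \<in> components (spanning_part D B)" "B \<subseteq> arcs D"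
  shows "W \<subseteq> verts D"
proof -
  interpret P: wf_digraph "spanning_part D B"
    by (rule wf_digraph_spanning_part[OF assms(2)])
  show ?thesis
    using assms(1) P.component_of_subset_verts unfolding components_def by auto
qed

text \<open>The factors \<open>g\<close> and \<open>inv g\<close> fall into the same component and
  cancel, so every value on \<open>e\<close> is equally admissible.\<close>

lemma balanced_residual_same:
  assumes B: "insert e B \<subseteq> arcs D" and b: "b \<in> verts D \<rightarrow> carrier G" and g: "g \<in> carrier G"
    and eq: "component_of (spanning_part D B) (tail D e) = component_of (spanning_part D B) (head D e)"
  shows "balanced B (residual e g b) \<longleftrightarrow> balanced (insert e B) b"
proof -
  interpret P: wf_digraph "spanning_part D B"
    by (rule wf_digraph_spanning_part) (use B in auto)
  have "finprod G (residual e g b) W = finprod G b W" if "W \<in> components (spanning_part D B)" for W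
  proof -
    have W: "W \<subseteq> verts D" using components_subset_verts[OF that] B by auto
    have "head D e \<in> W \<longleftrightarrow> tail D e \<in> W"
      using that eq P.mem_component_of_iff[of "tail D e"] P.mem_component_of_iff[of "head D e"] B
      by (auto simp: components_def)
    moreover have "finprod G b W \<in> carrier G"
      using b W by (intro finprod_closed) auto
    ultimately show ?thesis
      using finprod_residual[OF b g W, of e] g by simp
  qed
  then show ?thesis
    unfolding balanced_def components_insert_same[OF B eq] by auto
qed

text \<open>With \<open>x\<close> and \<open>y\<close> the products of \<open>b\<close> over the two
  components, balance demands that \<open>x \<otimes> inv g\<close> and \<open>y \<otimes> g\<close>
  be trivial. The first forces \<open>g = x\<close>; the second then says that the merged component
  is balanced. So at most one value on \<open>e\<close> is admissible.\<close>

lemma balanced_residual_diff: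
  assumes B: "insert e B \<subseteq> arcs D" and b: "b \<in> verts D \<rightarrow> carrier G" and g: "g \<in> carrier G"
    and ne: "component_of (spanning_part D B) (tail D e) \<noteq> component_of (spanning_part D B) (head D e)"
  shows "balanced B (residual e g b) \<longleftrightarrow>
    balanced (insert e B) b \<and> g = finprod G b (component_of (spanning_part D B) (tail D e))"
proof -
  interpret P: wf_digraph "spanning_part D B"
    by (rule wf_digraph_spanning_part) (use B in auto)
  let ?W1 = "component_of (spanning_part D B) (tail D e)"
    and ?W2 = "component_of (spanning_part D B) (head D e)"
    and ?C = "components (spanning_part D B)"
  have mem: "?W1 \<in> ?C" "?W2 \<in> ?C"
    using B by (auto simp: components_def)
  have ends: "tail D e \<in> ?W1" "head D e \<in> ?W2"
    using B by (auto intro!: P.component_of_self)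
  have only: "tail D e \<in> W \<longleftrightarrow> W = ?W1" "head D e \<in> W \<longleftrightarrow> W = ?W2" if "W \<in> ?C" for W
    using P.component_eq_component_of[OF that] ends by blast+
  have sub: "W \<subseteq> verts D" if "W \<in> ?C" for W
    using components_subset_verts[OF that] B by auto
  have closed: "finprod G b W \<in> carrier G" if "W \<in> ?C" for W
    using b sub[OF that] by (intro finprod_closed) auto
  have res: "finprod G (residual e g b) W = finprod G b W \<otimes>
      ((if W = ?W2 then g else \<one>) \<otimes> (if W = ?W1 then inv g else \<one>))" if "W \<in> ?C" for W
    using finprod_residual[OF b g sub[OF that], of e] only[OF that] by simp
  let ?x = "finprod G b ?W1" and ?y = "finprod G b ?W2"
  have un: "finprod G b (?W1 \<union> ?W2) = ?x \<otimes> ?y"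
    using P.components_disjoint[OF mem ne] sub[OF mem(1)] sub[OF mem(2)] b
    by (intro finprod_Un_disjoint) (auto intro: finite_subset)
  have rest: "finprod G (residual e g b) W = finprod G b W" if "W \<in> ?C - {?W1, ?W2}" for W
    using res[of W] that closed[of W] by simp
  have "balanced B (residual e g b) \<longleftrightarrow>
      (\<forall>W \<in> ?C - {?W1, ?W2}. finprod G b W = \<one>) \<and> ?x \<otimes> inv g = \<one> \<and> ?y \<otimes> g = \<one>"
  proof -
    have "balanced B (residual e g b) \<longleftrightarrow>
        (\<forall>W \<in> ?C - {?W1, ?W2}. finprod G (residual e g b) W = \<one>) \<and>
        finprod G (residual e g b) ?W1 = \<one> \<and> finprod G (residual e g b) ?W2 = \<one>"
      unfolding balanced_def using mem by blast
    also have "\<dots> \<longleftrightarrow> (\<forall>W \<in> ?C - {?W1, ?W2}. finprod G b W = \<one>) \<and>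
        ?x \<otimes> inv g = \<one> \<and> ?y \<otimes> g = \<one>"
      using rest res[OF mem(1)] res[OF mem(2)] ne g by simp
    finally show ?thesis .
  qed
  also have "?x \<otimes> inv g = \<one> \<and> ?y \<otimes> g = \<one> \<longleftrightarrow> ?x \<otimes> ?y = \<one> \<and> g = ?x"
  proof -
    have "?x \<otimes> inv g = \<one> \<longleftrightarrow> g = ?x"
      using closed[OF mem(1)] g by (metis inv_closed inv_equality inv_inv r_inv)
    then show ?thesis
      using closed[OF mem(1)] closed[OF mem(2)] by (auto simp: m_comm)
  qed
  also have "(\<forall>W \<in> ?C - {?W1, ?W2}. finprod G b W = \<one>) \<and> ?x \<otimes> ?y = \<one> \<and> g = ?x \<longleftrightarrow>
      balanced (insert e B) b \<and> g = ?x"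
    unfolding balanced_def components_insert[OF B] Let_def using un by auto
  finally show ?thesis .
qed

text \<open>Induction on \<open>B\<close>. An arc within a component gives one equal summand per
  group element and raises the exponent by one; an arc between components leaves a single summand
  and, because the rank rises too, the same exponent.\<close>

lemma card_flows_with_outflow:
  assumes "B \<subseteq> arcs D" and "b \<in> verts D \<rightarrow> carrier G"
  shows "card (flows_with_outflow B b) = (if balanced B b then Coset.order G ^ (card B - rk D B) else 0)"
proof -
  have "finite B" using assms(1) finite_arcs by (rule finite_subset)
  then show ?thesis using assms
  proof (induction arbitrary: b rule: finite_induct)
    case empty
    have "b v \<in> carrier G" if "v \<in> verts D" for v
      using empty that by auto
    then have "balanced {} b \<longleftrightarrow> (\<forall>v \<in> verts D. \<one> = b v)"
      by (auto simp: balanced_def components_empty)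
    \<comment> \<open>With no arcs all products are empty, and the only extensional map is the
      constant \<open>undefined\<close>.\<close>
    moreover have "flows_with_outflow {} b = (if \<forall>v \<in> verts D. \<one> = b v then {\<lambda>_. undefined} else {})"
      using empty by (auto simp: flows_with_outflow_def Pi_def)
    ultimately show ?case by (simp add: rk_empty)
  next
    case (insert e B)
    let ?W1 = "component_of (spanning_part D B) (tail D e)"
      and ?W2 = "component_of (spanning_part D B) (head D e)"
    let ?k = "Coset.order G"
    have B: "insert e B \<subseteq> arcs D" by fact
    have IH: "card (flows_with_outflow B (residual e g b)) =
        (if balanced B (residual e g b) then ?k ^ (card B - rk D B) else 0)" if "g \<in> carrier G" for g
      using insert.prems that by (intro insert.IH residual_closed) auto
    have step: "card (flows_with_outflow (insert e B) b) =
        (\<Sum>g \<in> carrier G. if balanced B (residual e g b) then ?k ^ (card B - rk D B) else 0)"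
      using card_flows_with_outflow_insert[OF B insert.hyps(2) insert.prems(2)] IH by simp
    show ?case
    proof (cases "?W1 = ?W2")
      case True
      have "card (flows_with_outflow (insert e B) b) =
          (\<Sum>g \<in> carrier G. if balanced (insert e B) b then ?k ^ (card B - rk D B) else 0)"
        unfolding step using balanced_residual_same[OF B insert.prems(2) _ True]
        by (intro sum.cong) auto
      moreover have "card (insert e B) - rk D (insert e B) = Suc (card B - rk D B)"
        using rk_le_card[of B] B True insert.hyps by (simp add: rk_insert Suc_diff_le)
      ultimately show ?thesis
        by (simp add: Coset.order_def)
    next
      case False
      \<comment> \<open>The forced value must lie in the carrier for its summand to occur in the sum
        over \<open>g\<close>.\<close>
      have x: "finprod G b ?W1 \<in> carrier G"
        using B insert.prems(2) components_subset_verts[of ?W1 B]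
        by (intro finprod_closed) (auto simp: components_def)
      have "card (flows_with_outflow (insert e B) b) =
          (\<Sum>g \<in> carrier G. if g = finprod G b ?W1 then
             if balanced (insert e B) b then ?k ^ (card B - rk D B) else 0 else 0)"
        unfolding step using balanced_residual_diff[OF B insert.prems(2) _ False]
        by (intro sum.cong) auto
      also have "\<dots> = (if balanced (insert e B) b then ?k ^ (card B - rk D B) else 0)"
        using x finite_carrier by simp
      moreover have "card (insert e B) - rk D (insert e B) = card B - rk D B"
        using False insert.hyps B by (simp add: rk_insert)
      ultimately show ?thesis by simp
    qed
  qed
qed

text \<open>Arcs that carry \<open>\<one>\<close> do not affect conservation, so such flows are, by
  restriction, the maps on \<open>B\<close> with zero outflow. Zero outflow is always
  balanced.\<close>

lemma card_flows_supp_subset: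
  assumes B: "B \<subseteq> arcs D"
  shows "card {f \<in> flows G D. supp G D f \<subseteq> B} = Coset.order G ^ (card B - rk D B)"
proof -
  let ?F = "{f \<in> flows G D. supp G D f \<subseteq> B}" and ?z = "\<lambda>_ :: 'a. \<one>"
  \<comment> \<open>The inverse of restriction to \<open>B\<close>: it puts \<open>\<one>\<close> on
    the remaining arcs and keeps \<open>undefined\<close> outside \<open>arcs D\<close>, so the
    result is again extensional.\<close>
  define ext where "ext f = (\<lambda>a. if a \<in> arcs D - B then \<one> else f a)" for f :: "'b \<Rightarrow> 'g"
  have sums: "finprod G f {a \<in> arcs D. p a = v} = finprod G (restrict f B) {a \<in> B. p a = v}"
    if "f \<in> arcs D \<rightarrow>\<^sub>E carrier G" "supp G D f \<subseteq> B" for f v and p :: "'b \<Rightarrow> 'a"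
    using that B by (intro finprod_mono_neutral_cong_right) (auto simp: supp_def)
  have closed: "finprod G (restrict f B) {a \<in> B. p a = v} \<in> carrier G"
    if "f \<in> arcs D \<rightarrow>\<^sub>E carrier G" for f v and p :: "'b \<Rightarrow> 'a"
    using that B by (intro finprod_closed) auto
  have flow_iff: "f \<in> flows G D \<longleftrightarrow> restrict f B \<in> flows_with_outflow B ?z"
    if f: "f \<in> arcs D \<rightarrow>\<^sub>E carrier G" "supp G D f \<subseteq> B" for f
  proof -
    have "restrict f B \<in> B \<rightarrow>\<^sub>E carrier G" using f B by auto
    then show ?thesis
      using f sums[OF f] closed[OF f(1)]
      by (simp add: flows_def flows_with_outflow_def in_arcs_def out_arcs_def)
  qed
  have "bij_betw (\<lambda>f. restrict f B) ?F (flows_with_outflow B ?z)"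
  proof (rule bij_betwI[where g = ext])
    show "(\<lambda>f. restrict f B) \<in> ?F \<rightarrow> flows_with_outflow B ?z"
      using flow_iff by (auto simp: flows_def)
    have ext: "ext f \<in> arcs D \<rightarrow>\<^sub>E carrier G" "supp G D (ext f) \<subseteq> B" "restrict (ext f) B = f"
      if "f \<in> B \<rightarrow>\<^sub>E carrier G" for f
      using that B by (auto simp: ext_def supp_def PiE_def extensional_def Pi_def restrict_def fun_eq_iff)
    show "ext \<in> flows_with_outflow B ?z \<rightarrow> ?F"
    proof
      fix f
      assume f: "f \<in> flows_with_outflow B ?z"
      then have "f \<in> B \<rightarrow>\<^sub>E carrier G" by (simp add: flows_with_outflow_def)
      note e = ext[OF this]
      show "ext f \<in> ?F" using flow_iff[OF e(1,2)] e f by simp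
    qed
    show "restrict (ext f) B = f" if "f \<in> flows_with_outflow B ?z" for f
      using ext that by (simp add: flows_with_outflow_def)
    show "ext (restrict f B) = f" if "f \<in> ?F" for f
      using that by (auto simp: ext_def supp_def flows_def PiE_def extensional_def restrict_def fun_eq_iff)
  qed
  then have "card ?F = card (flows_with_outflow B ?z)"
    by (rule bij_betw_same_card)
  also have "balanced B ?z"
    by (simp add: balanced_def)
  then have "card (flows_with_outflow B ?z) = Coset.order G ^ (card B - rk D B)"
    using card_flows_with_outflow[OF B, of ?z] by simp
  finally show ?thesis .
qed

lemma finite_flows: "finite (flows G D)"
  unfolding flows_def
  by (rule finite_subset[of _ "arcs D \<rightarrow>\<^sub>E carrier G"]) (auto simp: finite_carrier intro!: finite_PiE)

end

section \<open>Moebius inversion\<close>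

context finite_poset
begin

text \<open>The defining recursion solved for zero: the Moebius function is inverse to the zeta
  function in the incidence algebra.\<close>

lemma sum_moebius:
  assumes "x \<in> P" "y \<in> P" "le x y"
  shows "(\<Sum>z \<in> {z \<in> P. le x z \<and> le z y}. moebius x z) = (if x = y then 1 else 0)"
proof -
  have "le y y" using assms refl_le by (auto dest: reflp_onD)
  let ?I = "{z \<in> P. le x z \<and> le z y \<and> z \<noteq> y}"
  have eq: "{z \<in> P. le x z \<and> le z y} = insert y ?I"
    using assms \<open>le y y\<close> by auto
  have "(\<Sum>z \<in> {z \<in> P. le x z \<and> le z y}. moebius x z) = moebius x y + (\<Sum>z \<in> ?I. moebius x z)"
    unfolding eq using finite_P by (subst sum.insert) auto
  \<comment> \<open>By antisymmetry nothing lies strictly between \<open>x\<close> and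
    itself.\<close>
  moreover have "(\<Sum>z \<in> ?I. moebius x z) = 0" if "x = y"
    using that antisym_le assms by (intro sum.neutral) (auto dest: antisymp_onD)
  ultimately show ?thesis
    using assms moebius.simps[of x y] by (cases "x = y") simp_all
qed

end

section \<open>Counting NL-flows by inversion over the closures of supports\<close>

lemma (in group_digraph) card_NL_flows:
  "int (card (NL_flows G D)) = poly (NL_flow_poly D) (int (Coset.order G))"
proof -
  interpret M: finite_poset "dicut_complements D" "(\<supseteq>)"
    by (rule finite_poset_dicut_complements)
  let ?P = "dicut_complements D" and ?A = "arcs D"
  \<comment> \<open>Deleting every dicut that misses the support gives the least member of
    \<open>?P\<close> containing it; \<open>supp_cl\<close> records this as a Galois-type
    equivalence.\<close>
  define cl where "cl f = ?A - \<Union>{C \<in> dicuts D. C \<inter> supp G D f = {}}" for f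
  have dicuts_sub: "C \<subseteq> ?A" if "C \<in> dicuts D" for C
    using that by (auto simp: dicuts_def cut_def)
  have finite_dicuts: "finite (dicuts D)"
    by (rule finite_subset[of _ "Pow ?A"]) (use dicuts_sub in blast, simp)
  have P_sub: "B \<subseteq> ?A" if "B \<in> ?P" for B
    using that by (auto simp: dicut_complements_def)
  have A_P: "?A \<in> ?P"
    unfolding dicut_complements_def by (intro CollectI exI[of _ "{}"]) simp
  have cl_P: "cl f \<in> ?P" for f
    unfolding dicut_complements_def cl_def using finite_dicuts
    by (intro CollectI exI[of _ "{C \<in> dicuts D. C \<inter> supp G D f = {}}"]) auto
  have supp_sub: "supp G D f \<subseteq> ?A" for f
    by (auto simp: supp_def)
  have supp_cl: "supp G D f \<subseteq> B \<longleftrightarrow> cl f \<subseteq> B" if B: "B \<in> ?P" for f B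
  proof
    assume sB: "supp G D f \<subseteq> B"
    obtain K where K: "B = ?A - \<Union>K" "K \<subseteq> dicuts D"
      using B by (auto simp: dicut_complements_def)
    then have "K \<subseteq> {C \<in> dicuts D. C \<inter> supp G D f = {}}"
      using sB by auto
    then show "cl f \<subseteq> B" using K by (auto simp: cl_def)
  next
    assume "cl f \<subseteq> B"
    moreover have "supp G D f \<subseteq> cl f"
      using supp_sub by (auto simp: cl_def)
    ultimately show "supp G D f \<subseteq> B" by blast
  qed
  have nonempty: "C \<noteq> {}" if "C \<in> dicuts D" for C
    using that by (auto simp: dicuts_def)
  have NL_iff: "totally_cyclic (contract D (supp G D f)) \<longleftrightarrow> ?A = cl f" for f
  proof -
    \<comment> \<open>Dicuts are nonempty sets of arcs, so nothing is deleted only if no dicut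
      misses the support.\<close>
    have "?A = cl f \<longleftrightarrow> \<Union>{C \<in> dicuts D. C \<inter> supp G D f = {}} = {}"
      using dicuts_sub unfolding cl_def by blast
    also have "\<dots> \<longleftrightarrow> (\<forall>C \<in> dicuts D. C \<inter> supp G D f \<noteq> {})"
      using nonempty by blast
    finally show ?thesis
      using totally_cyclic_contract_iff[OF supp_sub] by simp
  qed
  let ?mu = "M.moebius ?A"
  have "poly (NL_flow_poly D) (int (Coset.order G)) =
      (\<Sum>B \<in> ?P. ?mu B * int (Coset.order G) ^ (card B - rk D B))"
    by (simp add: NL_flow_poly_def poly_sum poly_monom)
  also have "\<dots> = (\<Sum>B \<in> ?P. ?mu B * (\<Sum>f \<in> flows G D. of_bool (cl f \<subseteq> B)))"
  proof (rule sum.cong)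
    fix B
    assume B: "B \<in> ?P"
    have "{f \<in> flows G D. supp G D f \<subseteq> B} = flows G D \<inter> {f. cl f \<subseteq> B}"
      using supp_cl[OF B] by auto
    then have "int (Coset.order G) ^ (card B - rk D B) = int (card (flows G D \<inter> {f. cl f \<subseteq> B}))"
      using card_flows_supp_subset[OF P_sub[OF B]] by simp
    also have "\<dots> = (\<Sum>f \<in> flows G D. of_bool (cl f \<subseteq> B))"
      using finite_flows by simp
    finally show "?mu B * int (Coset.order G) ^ (card B - rk D B) =
        ?mu B * (\<Sum>f \<in> flows G D. of_bool (cl f \<subseteq> B))"
      by simp
  qed simp
  \<comment> \<open>After the exchange each flow contributes the sum of the Moebius values of all
    \<open>B\<close> above its closure.\<close>
  also have "\<dots> = (\<Sum>f \<in> flows G D. \<Sum>B \<in> ?P. ?mu B * of_bool (cl f \<subseteq> B))"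
    by (subst sum.swap) (simp add: sum_distrib_left)
  \<comment> \<open>Under reverse inclusion \<open>?A\<close> is the least element, so this range is
    the interval from \<open>?A\<close> to \<open>cl f\<close>; by \<open>sum_moebius\<close> its
    sum vanishes unless the two agree.\<close>
  also have "\<dots> = (\<Sum>f \<in> flows G D. \<Sum>B \<in> {B \<in> ?P. ?A \<supseteq> B \<and> B \<supseteq> cl f}. ?mu B)"
    by (rule sum.cong[OF refl], rule sum.mono_neutral_cong_right) (use M.finite_P P_sub in auto)
  also have "\<dots> = (\<Sum>f \<in> flows G D. if ?A = cl f then 1 else 0)"
    by (intro sum.cong refl M.sum_moebius A_P cl_P) (auto simp: cl_def)
  also have "\<dots> = int (card {f \<in> flows G D. ?A = cl f})"
    using finite_flows by (simp add: sum.If_cases Int_def)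
  also have "{f \<in> flows G D. ?A = cl f} = NL_flows G D"
    using NL_iff by (simp add: NL_flows_def)
  finally show ?thesis by simp
qed

theorem theorem4:
  fixes D :: "('a,'b) pre_digraph" and G :: "('g,'m) monoid_scheme" and k :: nat
  assumes "fin_digraph D"
    and "comm_group G" and "finite (carrier G)" and "Coset.order G = k"
  shows "int (card (NL_flows G D)) = poly (NL_flow_poly D) (int k) \<and>
    (\<forall>H :: ('h,'n) monoid_scheme.
       comm_group H \<and> finite (carrier H) \<and> Coset.order H = k \<longrightarrow>
         card (NL_flows H D) = card (NL_flows G D))"
proof -
  have G: "int (card (NL_flows G D)) = poly (NL_flow_poly D) (int k)"
    using group_digraph.card_NL_flows[of D G] assms
    by (simp add: group_digraph_def group_digraph_axioms_def)
  \<comment> \<open>The polynomial is built from \<open>D\<close> alone, so it takes the same value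
    for \<open>H\<close>, even over another carrier type.\<close>
  moreover have "int (card (NL_flows H D)) = poly (NL_flow_poly D) (int k)"
    if "comm_group H \<and> finite (carrier H) \<and> Coset.order H = k" for H :: "('h,'n) monoid_scheme"
    using group_digraph.card_NL_flows[of D H] assms(1) that
    by (simp add: group_digraph_def group_digraph_axioms_def)
  ultimately show ?thesis
    by (metis of_nat_eq_iff)
qed

end
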